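(* Let $M\ge 2N$. Then for a generic $M$-element frame $\mathcal F=\{f_1,\dots,f_M\}$ for $\mathbb C^N$, the set of vectors $x\in\mathbb C^N$ such that every $y\in\mathbb C^N$ with $|\langle y,f_k\rangle|=|\langle x,f_k\rangle|$ for all $k$ satisfies $y=cx$ for some $|c|=1$ contains an open dense subset of $\mathbb C^N$.
   Context: An $M$-element frame for $\mathbb C^N$ is a spanning family $\{f_1,\dots,f_M\}\subset\mathbb C^N$, $\langle x,y\rangle=\sum_k x_k\overline{y_k}$; "generic" means for all frames in an open dense subset of the set of such frames (topology induced from the range of coefficients in the complex Grassmannian $Gr(N,M)^{\mathbb C}$). *)

theory Defs
  imports "HOL-Analysis.Analysis"
begin

definition cinner :: "complex^'n \<Rightarrow> complex^'n \<Rightarrow> complex" where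
  "cinner x y = (\<Sum>i\<in>UNIV. x $ i * cnj (y $ i))"

text \<open>An M-element family in C^N is encoded as F :: complex^'n^'m, with f_k = F $ k.
  It is a frame iff it spans C^N (over the complex numbers).\<close>
definition is_frame :: "complex^'n^'m \<Rightarrow> bool" where
  "is_frame F \<longleftrightarrow> (\<forall>x::complex^'n. \<exists>c::'m \<Rightarrow> complex. x = (\<Sum>k\<in>UNIV. c k *s F $ k))"

text \<open>Range of the analysis operator x |-> (<x,f_k>)_k, an N-dimensional subspace of C^M
  (the point of the Grassmannian associated with the frame).\<close>
definition analysis_range :: "complex^'n^'m \<Rightarrow> (complex^'m) set" where
  "analysis_range F = range (\<lambda>x::complex^'n. \<chi> k. cinner x (F $ k))"

text \<open>A set of frames is open in the topology induced from the Grassmannian iff it is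
  open and saturated w.r.t. having the same analysis range.  "Generic" property:
  holds on an open dense subset of the frames in this topology.\<close>
definition generic_frames :: "(complex^'n^'m \<Rightarrow> bool) \<Rightarrow> bool" where
  "generic_frames P \<longleftrightarrow>
     (\<exists>U. U \<subseteq> {F. is_frame F} \<and> open U \<and> {F. is_frame F} \<subseteq> closure U
        \<and> (\<forall>F G. F \<in> U \<and> is_frame G \<and> analysis_range G = analysis_range F \<longrightarrow> G \<in> U)
        \<and> (\<forall>F\<in>U. P F))"

definition phase_retrievable_vectors :: "complex^'n^'m \<Rightarrow> (complex^'n) set" where
  "phase_retrievable_vectors F =
     {x. \<forall>y. (\<forall>k. cmod (cinner y (F $ k)) = cmod (cinner x (F $ k)))
              \<longrightarrow> (\<exists>c. cmod c = 1 \<and> y = c *s x)}"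

end

theory Submission
  imports Defs "HOL-Computational_Algebra.Polynomial"
begin

text \<open>
  Let \<open>N\<close> be the dimension. If \<open>y\<close> has the same magnitudes as \<open>x\<close>, then \<open>w = y\<close>, \<open>z = conj y\<close> solve the bilinear
  system \<open>(u\<^sub>k \<cdot> w) (v\<^sub>k \<cdot> z) = a\<^sub>k\<close> with \<open>u\<^sub>k = conj f\<^sub>k\<close>, \<open>v\<^sub>k = f\<^sub>k\<close>. Eliminating the constants pairwise makes
  it homogeneous, and multiplying by monomials in \<open>w\<close> makes it a linear system for the
  tensor \<open>w \<otimes> \<dots> \<otimes> w \<otimes> z\<close>. Whenever the solution space of this linear system is one-dimensional,
  \<open>y\<close> is proportional to \<open>x\<close>. One-dimensionality is implied by the nonvanishing of a determinant that is
  polynomial in \<open>u, v, x, conj x\<close>, so it suffices to exhibit one point where the determinant is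
  nonzero, and that point may have \<open>u\<close>, \<open>v\<close> (and \<open>x\<close>, \<open>conj x\<close>) unrelated, as a polynomial
  vanishing on all real points vanishes identically. For \<open>2N - 1\<close> of the vectors take
  \<open>u\<^sub>k = v\<^sub>k = (1, t, \<dots>, t^(N-1))\<close>, which measure the product of the polynomials with
  coefficients \<open>w\<close> and \<open>z\<close>, and for one more \<open>u = e\<^sub>0\<close>, \<open>v = e\<^sub>N\<^sub>-\<^sub>1\<close>; at
  \<open>w = e\<^sub>0\<close>, \<open>z = e\<^sub>N\<^sub>-\<^sub>1\<close> the linear system is solved by an induction over monomials.
\<close>

subsection \<open>A linear system on words\<close>

definition occ :: "nat \<Rightarrow> ('s::finite \<Rightarrow> nat) \<Rightarrow> nat" where
  "occ a \<beta> = card {s. \<beta> s = a}"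

lemma occ_upd:
  assumes "\<beta> s = a" "i \<noteq> a"
  shows "occ a \<beta> = Suc (occ a (\<beta>(s := i)))" "occ i (\<beta>(s := i)) = Suc (occ i \<beta>)"
    and "b \<noteq> a \<Longrightarrow> b \<noteq> i \<Longrightarrow> occ b (\<beta>(s := i)) = occ b \<beta>"
proof -
  have "{s. \<beta> s = a} = insert s {s'. (\<beta>(s := i)) s' = a}" "s \<notin> {s'. (\<beta>(s := i)) s' = a}"
    using assms by (auto split: if_splits)
  thus "occ a \<beta> = Suc (occ a (\<beta>(s := i)))" by (simp add: occ_def)
  have "{s'. (\<beta>(s := i)) s' = i} = insert s {s. \<beta> s = i}" "s \<notin> {s. \<beta> s = i}"
    using assms by (auto split: if_splits)
  thus "occ i (\<beta>(s := i)) = Suc (occ i \<beta>)" by (simp add: occ_def)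
  assume "b \<noteq> a" "b \<noteq> i"
  hence "{s'. (\<beta>(s := i)) s' = b} = {s. \<beta> s = b}"
    using assms by (auto split: if_splits)
  thus "occ b (\<beta>(s := i)) = occ b \<beta>" by (simp add: occ_def)
qed

lemma occ_pos: "occ a \<beta> > 0 \<Longrightarrow> \<exists>s. \<beta> s = a"
  unfolding occ_def by (metis (mono_tags) card.empty empty_Collect_eq less_irrefl)

lemma sum_occ:
  fixes \<beta> :: "'s::finite \<Rightarrow> nat"
  assumes "\<And>s. \<beta> s < N"
  shows "(\<Sum>a<N. occ a \<beta>) = CARD('s)"
proof -
  have "(\<Sum>a<N. occ a \<beta>) = card (\<Union>a\<in>{..<N}. {s. \<beta> s = a})"
    unfolding occ_def by (rule card_UN_disjoint [symmetric]) auto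
  also have "(\<Union>a\<in>{..<N}. {s. \<beta> s = a}) = UNIV"
    using assms by auto
  finally show ?thesis by simp
qed

text \<open>Lexicographic order on the vectors \<open>(occ 0, occ 1, \<dots>)\<close>; going up means replacing letters by smaller ones.\<close>

definition lex_above :: "('s::finite \<Rightarrow> nat) \<Rightarrow> ('s \<Rightarrow> nat) \<Rightarrow> bool" where
  "lex_above \<gamma> \<beta> \<longleftrightarrow> (\<exists>b. (\<forall>i<b. occ i \<gamma> = occ i \<beta>) \<and> occ b \<gamma> > occ b \<beta>)"

lemma lex_above_trans: "lex_above a b \<Longrightarrow> lex_above b c \<Longrightarrow> lex_above a c"
proof -
  assume "lex_above a b" "lex_above b c"
  then obtain i j where i: "\<forall>k<i. occ k a = occ k b" "occ i a > occ i b"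
    and j: "\<forall>k<j. occ k b = occ k c" "occ j b > occ j c"
    unfolding lex_above_def by blast
  consider "i < j" | "i = j" | "j < i" by linarith
  thus "lex_above a c"
    unfolding lex_above_def
    by cases (use i j in \<open>(intro exI[of _ "min i j"]; auto simp: min_def)+\<close>)
qed

lemma wf_lex_above: 
  "wf {(\<gamma>, \<beta> :: 's::finite \<Rightarrow> nat). lex_above \<gamma> \<beta> \<and> (\<forall>s. \<gamma> s < N) \<and> (\<forall>s. \<beta> s < N)}" (is "wf ?R")
proof (rule finite_acyclic_wf)
  let ?B = "{\<beta> :: 's \<Rightarrow> nat. \<forall>s. \<beta> s < N}"
  have "finite ?B"
    using finite_PiE[of "UNIV :: 's set" "\<lambda>_. {..<N}"] by (simp add: PiE_def Pi_def)
  hence "finite (?B \<times> ?B)" by simp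
  thus "finite ?R" by (rule finite_subset[rotated]) auto
  have "trans ?R"
    unfolding trans_def using lex_above_trans by blast
  moreover have "irrefl ?R"
    by (auto simp: irrefl_def lex_above_def)
  ultimately show "acyclic ?R"
    by (simp add: acyclic_irrefl)
qed

text \<open>
  \<open>D \<beta> j\<close> stands for the value of a linear functional at the monomial \<open>(\<Prod>s. w (\<beta> s)) * z j\<close>; the assumption \<open>rel\<close> says that
  \<open>(\<Sum>i. w i * t ^ i) * (\<Sum>j. z j * t ^ j) - w 0 * z (N - 1) * t ^ (N - 1)\<close>, multiplied by any monomial in \<open>w\<close>,
  is mapped to \<open>0\<close>.
\<close>

context
  fixes D :: "('s::finite \<Rightarrow> nat) \<Rightarrow> nat \<Rightarrow> 'a::ring_1" and N :: nat
  assumes N: "N \<ge> 1"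
    and rel: "\<And>s \<beta> m. (\<And>s'. \<beta> s' < N) \<Longrightarrow> m < 2 * N - 1 \<Longrightarrow>
      (\<Sum>(i,j) | i < N \<and> j < N \<and> (i, j) \<noteq> (0, N - 1) \<and> i + j = m. D (\<beta>(s := i)) j) = 0"
    and nrm: "D (\<lambda>_. 0) (N - 1) = 0"
begin

text \<open>The relation for slot \<open>s\<close> in degree \<open>\<beta> s + j\<close> contains
  \<open>D \<beta> j\<close> itself, as its term with \<open>i = \<beta> s\<close>.\<close>

lemma exchange:
  assumes \<beta>: "\<And>s. \<beta> s < N" and j: "j < N" and ne: "(\<beta> s, j) \<noteq> (0, N - 1)"
    and van: "\<And>i k. i < N \<Longrightarrow> k < N \<Longrightarrow> (i, k) \<noteq> (0, N - 1) \<Longrightarrow> i \<noteq> \<beta> s \<Longrightarrow> i + k = \<beta> s + j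
                \<Longrightarrow> D (\<beta>(s := i)) k = 0"
  shows "D \<beta> j = 0"
proof -
  let ?m = "\<beta> s + j"
  let ?S = "{(i,k). i < N \<and> k < N \<and> (i, k) \<noteq> (0, N - 1) \<and> i + k = ?m}"
  have fin: "finite ?S" by (rule finite_subset[of _ "{..<N} \<times> {..<N}"]) auto
  have mem: "(\<beta> s, j) \<in> ?S" using \<beta>[of s] j ne by auto
  have "?m < 2 * N - 1" using \<beta>[of s] j by linarith
  hence "0 = (\<Sum>(i,k)\<in>?S. D (\<beta>(s := i)) k)"
    using rel[where \<beta> = \<beta> and s = s and m = ?m] \<beta> by simp
  also have "\<dots> = D (\<beta>(s := \<beta> s)) j + (\<Sum>(i,k)\<in>?S - {(\<beta> s, j)}. D (\<beta>(s := i)) k)"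
    using sum.remove[OF fin mem, of "\<lambda>(i,k). D (\<beta>(s := i)) k"] by simp
  also have "(\<Sum>(i,k)\<in>?S - {(\<beta> s, j)}. D (\<beta>(s := i)) k) = 0"
  proof (rule sum.neutral, rule ballI)
    fix p assume p: "p \<in> ?S - {(\<beta> s, j)}"
    hence "fst p \<noteq> \<beta> s" by auto
    thus "(case p of (i, k) \<Rightarrow> D (\<beta>(s := i)) k) = 0"
      using p van by auto
  qed
  finally show ?thesis by simp
qed

text \<open>Trade a letter 0 for a larger letter \<open>i\<close>: since \<open>i + k = j\<close>,
  the last index drops to \<open>k < j\<close>, while only one 0 is lost, so 0 still occurs more
  than \<open>k\<close> times.\<close>

lemma vanish_if_many_zeros_aux:
  assumes "\<And>s. \<beta> s < N" "j < N - 1" "occ 0 \<beta> > j"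
  shows "D \<beta> j = 0"
  using assms
proof (induction j arbitrary: \<beta> rule: less_induct)
  case (less j)
  obtain s where s: "\<beta> s = 0" using occ_pos[of 0 \<beta>] less.prems by auto
  show ?case
  proof (rule exchange[of _ _ s])
    fix i k assume ik: "i < N" "k < N" "i \<noteq> \<beta> s" "i + k = \<beta> s + j"
    hence "k < j" using s by auto
    thus "D (\<beta>(s := i)) k = 0"
      using less.prems occ_upd(1)[of \<beta> s 0 i] s ik
      by (intro less.IH) (auto simp del: fun_upd_apply, auto)
  qed (use less.prems s in auto)
qed

lemma vanish_if_many_zeros:
  assumes \<beta>: "\<And>s. \<beta> s < N" and j: "j < N" and z: "occ 0 \<beta> \<ge> N - 1"
  shows "D \<beta> j = 0"
proof (cases "j < N - 1")
  case True
  thus ?thesis using vanish_if_many_zeros_aux[of \<beta> j] assms by auto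
next
  case False
  hence [simp]: "j = N - 1" using j by auto
  show ?thesis
  proof (cases "\<beta> = (\<lambda>_. 0)")
    case True thus ?thesis using nrm by simp
  next
    case False
    \<comment> \<open>For \<open>j = N - 1\<close> a slot holding 0 would hit the excluded pair, so
      a nonzero letter is exchanged. Then \<open>i + k > N - 1\<close> forces
      \<open>i \<noteq> 0\<close>, so no 0 is lost, and \<open>k < N - 1\<close> reduces to the
      previous lemma.\<close>
    then obtain s where s: "\<beta> s \<noteq> 0" by auto
    show ?thesis
    proof (rule exchange[of _ _ s])
      fix i k assume ik: "i < N" "k < N" "i \<noteq> \<beta> s" "i + k = \<beta> s + j" "(i, k) \<noteq> (0, N - 1)"
      have "i \<noteq> 0" using ik s by auto
      hence "occ 0 (\<beta>(s := i)) = occ 0 \<beta>" using occ_upd(3)[of \<beta> s "\<beta> s" i 0] ik s by auto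
      moreover have "k \<noteq> N - 1" using ik by auto
      ultimately show "D (\<beta>(s := i)) k = 0"
        using z ik \<beta> by (intro vanish_if_many_zeros_aux) auto
    qed (use \<beta> j s in auto)
  qed
qed

text \<open>The same descent with \<open>a\<close> in place of 0: terms with \<open>i < a\<close>
  are lexicographically higher and fall under \<open>IH\<close>, terms with \<open>i > a\<close>
  have a smaller last index. The exchange changes the word, hence \<open>\<gamma>\<close>; only the
  counts below \<open>a\<close> stay fixed.\<close>

lemma vanish_if_many_equal_letters:
  assumes \<beta>: "\<And>s. \<beta> s < N" and a: "0 < a"
    and IH: "\<And>\<gamma> j. lex_above \<gamma> \<beta> \<Longrightarrow> (\<And>s. \<gamma> s < N) \<Longrightarrow> j < N \<Longrightarrow> D \<gamma> j = 0"
  shows "(\<And>s. \<gamma> s < N) \<Longrightarrow> \<forall>b<a. occ b \<gamma> = occ b \<beta> \<Longrightarrow> j < N \<Longrightarrow> occ a \<gamma> > j \<Longrightarrow> D \<gamma> j = 0"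
proof (induction j arbitrary: \<gamma> rule: less_induct)
  case (less j)
  obtain s where s: "\<gamma> s = a" using occ_pos[of a \<gamma>] less.prems by auto
  show ?case
  proof (rule exchange[of _ _ s])
    fix i k assume ik: "i < N" "k < N" "i \<noteq> \<gamma> s" "i + k = \<gamma> s + j"
    have lt: "\<And>s'. (\<gamma>(s := i)) s' < N" using ik less.prems(1) by auto
    show "D (\<gamma>(s := i)) k = 0"
    proof (cases "i < a")
      case True
      have "lex_above (\<gamma>(s := i)) \<beta>"
        unfolding lex_above_def
      proof (intro exI[of _ i] conjI allI impI)
        fix b assume "b < i"
        thus "occ b (\<gamma>(s := i)) = occ b \<beta>"
          using occ_upd(3)[of \<gamma> s a i b] s ik True less.prems(2) by auto
      next
        show "occ i \<beta> < occ i (\<gamma>(s := i))"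
          using occ_upd(2)[of \<gamma> s a i] s ik True less.prems(2) by auto
      qed
      thus ?thesis using IH lt ik by blast
    next
      case False
      hence "i > a" "k < j" using ik s by auto
      moreover have "\<forall>b<a. occ b (\<gamma>(s := i)) = occ b \<beta>"
        using occ_upd(3)[of \<gamma> s a i] s ik less.prems(2) \<open>i > a\<close> by auto
      ultimately show ?thesis
        using less.prems(4) occ_upd(1)[of \<gamma> s a i] s ik lt
        by (intro less.IH) (auto simp del: fun_upd_apply)
    qed
  qed (use less.prems s a in auto)
qed

text \<open>By pigeonhole some letter occurs at least \<open>N > j\<close> times, so one of the two
  preceding lemmas applies; lexicographically higher words come from the induction.\<close>

lemma vanish_everywhere:
  assumes card: "N * (N - 1) < CARD('s)"
    and "\<And>s. \<beta> s < N" "j < N"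
  shows "D \<beta> j = 0"
  using assms(2,3)
proof (induction \<beta> arbitrary: j rule: wf_induct_rule[OF wf_lex_above[of N]])
  case (1 \<beta>)
  have "\<exists>a<N. occ a \<beta> \<ge> N"
  proof (rule ccontr)
    assume "\<not> ?thesis"
    hence "(\<Sum>a<N. occ a \<beta>) \<le> (\<Sum>a<N. N - 1)"
      by (intro sum_mono) fastforce
    thus False using sum_occ[of \<beta> N] 1 card by auto
  qed
  then obtain a where a: "a < N" "occ a \<beta> \<ge> N" by blast
  show ?case
  proof (cases "a = 0")
    case True
    thus ?thesis using vanish_if_many_zeros[of \<beta> j] 1 a by auto
  next
    case False
    show ?thesis
      by (rule vanish_if_many_equal_letters[of \<beta> a \<beta>]) (use 1 False a in auto)
  qed
qed

end

text \<open>The sums in \<open>van\<close> are the values of a polynomial of degree at most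
  \<open>2 * N - 2\<close> at \<open>2 * N - 1\<close> distinct points.\<close>

lemma coeffs_vanish:
  fixes c :: "nat \<times> nat \<Rightarrow> 'a::{idom,ring_char_0}"
  assumes S: "S \<subseteq> {..<N} \<times> {..<N}"
    and van: "\<And>r. r < 2 * N - 1 \<Longrightarrow> (\<Sum>(i,j)\<in>S. of_nat r ^ (i + j) * c (i, j)) = 0"
  shows "(\<Sum>p | p \<in> S \<and> fst p + snd p = m. c p) = 0"
proof -
  have fin: "finite S" using S finite_subset by blast
  define p where "p = (\<Sum>q\<in>S. monom (c q) (fst q + snd q))"
  have ev: "poly p (of_nat r) = 0" if "r < 2 * N - 1" for r
    using van[OF that] unfolding p_def
    by (simp add: poly_sum poly_monom case_prod_unfold mult.commute)
  have "p = 0"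
  proof (cases "N = 0")
    case True thus ?thesis using S by (simp add: p_def)
  next
    case False
    show ?thesis
    proof (rule ccontr)
      assume "p \<noteq> 0"
      have "degree p \<le> 2 * N - 2"
        unfolding p_def
      proof (rule degree_sum_le[OF fin])
        fix q assume "q \<in> S"
        hence "fst q < N" "snd q < N" using S by auto
        thus "degree (monom (c q) (fst q + snd q)) \<le> 2 * N - 2"
          using degree_monom_le[of "c q" "fst q + snd q"] by linarith
      qed
      moreover have "2 * N - 1 \<le> card {x. poly p x = 0}"
      proof -
        have "card (of_nat ` {..<2 * N - 1} :: 'a set) = 2 * N - 1"
          by (subst card_image) (auto simp: inj_on_def)
        moreover have "card (of_nat ` {..<2 * N - 1} :: 'a set) \<le> card {x. poly p x = 0}"
          using ev poly_roots_finite[OF \<open>p \<noteq> 0\<close>] by (intro card_mono) auto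
        ultimately show ?thesis by simp
      qed
      ultimately show False
        using card_poly_roots_bound[OF \<open>p \<noteq> 0\<close>] False by linarith
    qed
  qed
  hence "coeff p m = 0" by simp
  thus ?thesis
    using fin by (simp add: p_def coeff_sum sum.If_cases Collect_conj_eq Int_commute)
qed

subsection \<open>The elimination operator\<close>

definition meas :: "complex^'n^'m \<Rightarrow> complex^'n^'m \<Rightarrow> 'm \<Rightarrow> complex^'n \<Rightarrow> complex^'n \<Rightarrow> complex" where
  "meas u v k w z = (\<Sum>i\<in>UNIV. u $ k $ i * w $ i) * (\<Sum>j\<in>UNIV. v $ k $ j * z $ j)"

text \<open>
  A tensor has \<open>N\<^sup>2\<close> slots for \<open>w\<close> and one for \<open>z\<close>: in \<open>N\<^sup>2 > N (N - 1)\<close> slots some letter occurs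
  at least \<open>N\<close> times, which starts the lexicographic reduction.
\<close>

type_synonym 'n tensor = "complex^(('n \<times> 'n \<Rightarrow> 'n) \<times> 'n)"

text \<open>
  The rows \<open>Some (s, \<beta>, k, l)\<close> express \<open>a\<^sub>l (u\<^sub>k \<cdot> w) (v\<^sub>k \<cdot> z) - a\<^sub>k (u\<^sub>l \<cdot> w) (v\<^sub>l \<cdot> z) = 0\<close> in slot \<open>s\<close>, with the
  remaining slots given by \<open>\<beta>\<close>; the row \<open>None\<close> normalises one coordinate, so that injectivity means that
  the other rows have an at most one-dimensional kernel.
\<close>

definition elim_op :: "'n \<Rightarrow> 'n \<Rightarrow> complex^'n^'m \<Rightarrow> complex^'n^'m \<Rightarrow> complex^'n \<Rightarrow> complex^'n
    \<Rightarrow> 'n::finite tensor \<Rightarrow> complex^((('n \<times> 'n) \<times> ('n \<times> 'n \<Rightarrow> 'n) \<times> 'm \<times> 'm) option)" where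
  "elim_op a b u v x z D = (\<chi> r. case r of None \<Rightarrow> D $ (\<lambda>_. a, b) | Some (s, \<beta>, k, l) \<Rightarrow>
     \<Sum>i\<in>UNIV. \<Sum>j\<in>UNIV. (meas u v l x z * (u $ k $ i * v $ k $ j) - meas u v k x z * (u $ l $ i * v $ l $ j))
       * D $ (\<beta>(s := i), j))"

lemma elim_op_None: "elim_op a b u v x z D $ None = D $ (\<lambda>_. a, b)"
  by (simp add: elim_op_def)

lemma elim_op_Some: "elim_op a b u v x z D $ Some (s, \<beta>, k, l) =
   (\<Sum>i\<in>UNIV. \<Sum>j\<in>UNIV. (meas u v l x z * (u $ k $ i * v $ k $ j) - meas u v k x z * (u $ l $ i * v $ l $ j))
       * D $ (\<beta>(s := i), j))"
  by (simp add: elim_op_def)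

lemma linear_elim_op:
  fixes u v :: "complex^'n::finite^'m::finite"
  shows "Vector_Spaces.linear (*s) (*s) (elim_op a b u v x z)"
proof unfold_locales
  fix D E :: "'n tensor" and c :: complex
  have "elim_op a b u v x z (D + E) $ r = (elim_op a b u v x z D + elim_op a b u v x z E) $ r" for r
    by (cases r) (auto simp: elim_op_None elim_op_Some distrib_left sum.distrib)
  thus "elim_op a b u v x z (D + E) = elim_op a b u v x z D + elim_op a b u v x z E"
    by (simp add: vec_eq_iff)
  have "elim_op a b u v x z (c *s D) $ r = (c *s elim_op a b u v x z D) $ r" for r
    by (cases r) (auto simp: elim_op_None elim_op_Some sum_distrib_left mult.left_commute)
  thus "elim_op a b u v x z (c *s D) = c *s elim_op a b u v x z D"
    by (simp add: vec_eq_iff)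
qed

lemma elim_op_injective_witness:
  assumes "CARD('m::finite) \<ge> 2 * CARD('n::finite)"
  obtains a b :: "'n::finite" and u v :: "complex^'n^'m::finite" and x z :: "complex^'n"
  where "\<And>D. elim_op a b u v x z D = 0 \<Longrightarrow> D = 0"
proof -
  define N where "N = CARD('n)"
  have N: "N \<ge> 1" by (simp add: N_def Suc_leI)
  obtain idx :: "'n \<Rightarrow> nat" where idx: "bij_betw idx UNIV {0..<N}"
    using ex_bij_betw_finite_nat[of "UNIV :: 'n set"] by (auto simp: N_def)
  obtain h :: "'m \<Rightarrow> nat" where h: "bij_betw h UNIV {0..<CARD('m)}"
    using ex_bij_betw_finite_nat[of "UNIV :: 'm set"] by auto
  define L where "L = inv_into UNIV idx"
  define H where "H = inv_into UNIV h"
  have bijL: "bij_betw L {..<N} UNIV"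
    using bij_betw_inv_into[OF idx] by (simp add: L_def lessThan_atLeast0)
  have iL: "idx (L i) = i" if "i < N" for i
    using bij_betw_inv_into_right[OF idx] that by (simp add: L_def)
  have Li: "L (idx i) = i" for i
    using bij_betw_inv_into_left[OF idx] by (simp add: L_def)
  have ilt: "idx i < N" for i
    using bij_betwE[OF idx] by simp
  have hH: "h (H r) = r" if "r < 2 * N" for r
    using bij_betw_inv_into_right[OF h] that assms by (simp add: H_def N_def)
  have idx_eq: "L i = L j \<longleftrightarrow> i = j" if "i < N" "j < N" for i j
    using iL that by metis
  \<comment> \<open>Vandermonde rows at the nodes 0, ..., \<open>2 * N - 2\<close>; all remaining
    rows equal the extra one, and there is at least one because
    \<open>CARD('m) \<ge> 2 * N\<close>.\<close>
  define u :: "complex^'n^'m" where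
    "u = (\<chi> k i. if h k < 2 * N - 1 then of_nat (h k) ^ idx i else if i = L 0 then 1 else 0)"
  define v :: "complex^'n^'m" where
    "v = (\<chi> k j. if h k < 2 * N - 1 then of_nat (h k) ^ idx j else if j = L (N - 1) then 1 else 0)"
  define x :: "complex^'n" where "x = axis (L 0) 1"
  define z :: "complex^'n" where "z = axis (L (N - 1)) 1"
  have meas: "meas u v k x z = u $ k $ L 0 * v $ k $ L (N - 1)" for k
  proof -
    have 1: "(\<Sum>i\<in>UNIV. u $ k $ i * x $ i) = u $ k $ L 0"
      by (subst sum.mono_neutral_right[of UNIV "{L 0}"]) (auto simp: x_def axis_def)
    have 2: "(\<Sum>i\<in>UNIV. v $ k $ i * z $ i) = v $ k $ L (N - 1)"
      by (subst sum.mono_neutral_right[of UNIV "{L (N - 1)}"]) (auto simp: z_def axis_def)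
    show ?thesis by (simp only: meas_def 1 2)
  qed
  have "D = 0" if D: "elim_op (L 0) (L (N - 1)) u v x z D = 0" for D
  proof -
    define D' where "D' \<beta> j = D $ (L \<circ> \<beta>, L j)" for \<beta> :: "'n \<times> 'n \<Rightarrow> nat" and j
    have rel: "(\<Sum>(i,j) | i < N \<and> j < N \<and> (i, j) \<noteq> (0, N - 1) \<and> i + j = m. D' (\<beta>(s := i)) j) = 0"
      for s \<beta> m
    proof -
      let ?S = "{..<N} \<times> {..<N} - {(0, N - 1)}"
      have "(\<Sum>(i,j)\<in>?S. of_nat r ^ (i + j) * D' (\<beta>(s := i)) j) = 0" if r: "r < 2 * N - 1" for r
      proof -
        let ?l = "H (2 * N - 1)" and ?k = "H r"
        have h': "h ?k = r" "h ?l = 2 * N - 1" using r by (auto intro!: hH)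
        \<comment> \<open>The extra row \<open>?l\<close> has measurement 1 and row
          \<open>?k\<close> has measurement \<open>r ^ (N - 1)\<close>, so the subtracted term
          cancels the coefficient at \<open>(0, N - 1)\<close> and touches no other.\<close>
        define C :: "nat \<Rightarrow> nat \<Rightarrow> complex"
          where "C i j = of_nat r ^ (i + j) - (if i = 0 \<and> j = N - 1 then of_nat r ^ (N - 1) else 0)" for i j
        have "0 = elim_op (L 0) (L (N - 1)) u v x z D $ Some (s, L \<circ> \<beta>, ?k, ?l)"
          using D by simp
        also have "\<dots> = (\<Sum>i<N. \<Sum>j<N. (meas u v ?l x z * (u $ ?k $ L i * v $ ?k $ L j)
            - meas u v ?k x z * (u $ ?l $ L i * v $ ?l $ L j)) * D $ ((L \<circ> \<beta>)(s := L i), L j))"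
          unfolding elim_op_Some by (simp only: sum.reindex_bij_betw[OF bijL, symmetric])
        also have "\<dots> = (\<Sum>i<N. \<Sum>j<N. C i j * D' (\<beta>(s := i)) j)"
        proof (intro sum.cong refl)
          fix i j assume ij: "i \<in> {..<N}" "j \<in> {..<N}"
          have "(L \<circ> \<beta>)(s := L i) = L \<circ> \<beta>(s := i)" by auto
          moreover have "meas u v ?l x z * (u $ ?k $ L i * v $ ?k $ L j)
            - meas u v ?k x z * (u $ ?l $ L i * v $ ?l $ L j) = C i j"
            using ij r N h'[unfolded One_nat_def] unfolding meas
            by (auto simp: u_def v_def C_def iL idx_eq power_add)
          ultimately show "(meas u v ?l x z * (u $ ?k $ L i * v $ ?k $ L j)
            - meas u v ?k x z * (u $ ?l $ L i * v $ ?l $ L j)) * D $ ((L \<circ> \<beta>)(s := L i), L j)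
             = C i j * D' (\<beta>(s := i)) j"
            by (simp only: D'_def)
        qed
        also have "\<dots> = (\<Sum>(i,j)\<in>{..<N} \<times> {..<N}. C i j * D' (\<beta>(s := i)) j)"
          by (simp add: sum.cartesian_product)
        also have "\<dots> = (\<Sum>(i,j)\<in>?S. of_nat r ^ (i + j) * D' (\<beta>(s := i)) j)"
          by (rule sum.mono_neutral_cong_right) (auto simp: C_def split: if_splits)
        finally show ?thesis by simp
      qed
      hence "(\<Sum>p | p \<in> ?S \<and> fst p + snd p = m. case p of (i, j) \<Rightarrow> D' (\<beta>(s := i)) j) = 0"
        by (intro coeffs_vanish[where N = N]) auto
      moreover have "{p. p \<in> ?S \<and> fst p + snd p = m}
        = {(i, j). i < N \<and> j < N \<and> (i, j) \<noteq> (0, N - 1) \<and> i + j = m}" by auto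
      ultimately show ?thesis by simp
    qed
    have nrm: "D' (\<lambda>_. 0) (N - 1) = 0"
      using elim_op_None[of "L 0" "L (N - 1)" u v x z D] D by (simp add: D'_def comp_def)
    have card: "N * (N - 1) < CARD('n \<times> 'n)"
      using N by (simp add: N_def)
    show ?thesis
    proof (simp add: vec_eq_iff, intro allI)
      fix \<gamma> j
      have "D' (idx \<circ> \<gamma>) (idx j) = 0"
        by (rule vanish_everywhere[of N D', OF N rel nrm card]) (auto simp: ilt)
      thus "D $ (\<gamma>, j) = 0" by (simp add: D'_def comp_def Li)
    qed
  qed
  thus ?thesis by (rule that)
qed

section \<open>Rank-one tensors and recovery up to phase\<close>

definition power_tensor :: "complex^'n \<Rightarrow> complex^'n \<Rightarrow> 'n::finite tensor" where
  "power_tensor w z = (\<chi> p. (\<Prod>s\<in>UNIV. w $ fst p s) * z $ snd p)"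

lemma power_tensor_upd:
  "power_tensor w z $ (\<beta>(s := i), j) = (\<Prod>t\<in>UNIV - {s}. w $ \<beta> t) * (w $ i * z $ j)"
proof -
  have "(\<Prod>t\<in>UNIV. w $ (\<beta>(s := i)) t) = w $ i * (\<Prod>t\<in>UNIV - {s}. w $ (\<beta>(s := i)) t)"
    by (subst prod.remove[of _ s]) auto
  also have "(\<Prod>t\<in>UNIV - {s}. w $ (\<beta>(s := i)) t) = (\<Prod>t\<in>UNIV - {s}. w $ \<beta> t)"
    by (intro prod.cong) auto
  finally show ?thesis by (simp add: power_tensor_def)
qed

text \<open>The untouched slots factor out; what remains is a product of two common measurements
  minus itself.\<close>

lemma elim_op_power_tensor:
  assumes "\<And>k. meas u v k w w' = meas u v k x z"
  shows "elim_op a b u v x z (power_tensor w w') $ Some (s, \<beta>, k, l) = 0"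
proof -
  let ?R = "\<Prod>t\<in>UNIV - {s}. w $ \<beta> t"
  have m: "(\<Sum>i\<in>UNIV. \<Sum>j\<in>UNIV. (u $ k $ i * v $ k $ j) * (w $ i * w' $ j)) = meas u v k x z" for k
    unfolding assms[of k, symmetric] by (simp add: meas_def sum_product mult_ac)
  have "elim_op a b u v x z (power_tensor w w') $ Some (s, \<beta>, k, l)
    = ?R * (meas u v l x z * (\<Sum>i\<in>UNIV. \<Sum>j\<in>UNIV. (u $ k $ i * v $ k $ j) * (w $ i * w' $ j))
          - meas u v k x z * (\<Sum>i\<in>UNIV. \<Sum>j\<in>UNIV. (u $ l $ i * v $ l $ j) * (w $ i * w' $ j)))"
    unfolding elim_op_Some power_tensor_upd
    by (simp only: sum_distrib_left right_diff_distrib sum_subtractf[symmetric])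
      (intro sum.cong refl; simp add: algebra_simps)
  thus ?thesis by (simp add: m)
qed

text \<open>Put \<open>i\<close> in all positions except one word slot and let that slot run through
  \<open>l\<close>: the coordinates are multiples of \<open>y $ l\<close> and \<open>x $ l\<close>
  by factors independent of \<open>l\<close>.\<close>

lemma proportional_if_power_tensor_eq:
  fixes x y :: "complex^'n::finite"
  assumes eq: "c *s power_tensor y y' = d *s power_tensor x x'" and c: "c \<noteq> 0"
    and x': "x' $ i \<noteq> 0 \<longleftrightarrow> x $ i \<noteq> 0" and y': "y' $ i \<noteq> 0 \<longleftrightarrow> y $ i \<noteq> 0"
    and xi: "x $ i \<noteq> 0" and yi: "y $ i \<noteq> 0"
  shows "y = (y $ i / x $ i) *s x"
proof -
  fix s :: "'n \<times> 'n"
  let ?P = "\<lambda>w :: complex^'n. \<Prod>t\<in>UNIV - {s}. w $ i"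
  have *: "c * (?P y * (y $ l * y' $ i)) = d * (?P x * (x $ l * x' $ i))" for l
    using arg_cong[OF eq, of "\<lambda>D. D $ ((\<lambda>_. i)(s := l), i)"]
    by (simp add: power_tensor_upd del: prod_constant)
  have "y $ l = y $ i / x $ i * x $ l" for l
  proof -
    define p q where "p = c * (?P y * y' $ i)" and "q = d * (?P x * x' $ i)"
    have "p * y $ l = q * x $ l" "p * y $ i = q * x $ i"
      using *[of l] *[of i] by (simp_all add: p_def q_def mult_ac)
    moreover have "p \<noteq> 0"
      using c yi y' by (simp add: p_def)
    moreover from calculation have "p * (y $ l * x $ i) = p * (y $ i * x $ l)"
      by (metis (no_types) mult.assoc mult.commute)
    ultimately show ?thesis using xi by (simp add: field_simps)
  qed
  thus ?thesis unfolding vec_eq_iff vector_smult_component by blast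
qed

definition conj_vec :: "complex^'n \<Rightarrow> complex^'n" where
  "conj_vec x = (\<chi> i. cnj (x $ i))"

definition conj_mat :: "complex^'n^'m \<Rightarrow> complex^'n^'m" where
  "conj_mat A = (\<chi> i j. cnj (A $ i $ j))"

lemma meas_conj: "meas (conj_mat F) F k x (conj_vec x) = of_real ((cmod (cinner x (F $ k)))\<^sup>2)"
proof -
  have "(\<Sum>i\<in>UNIV. conj_mat F $ k $ i * x $ i) = cinner x (F $ k)"
    by (simp add: cinner_def conj_mat_def mult.commute)
  moreover have "(\<Sum>i\<in>UNIV. F $ k $ i * conj_vec x $ i) = cnj (cinner x (F $ k))"
    by (simp add: cinner_def conj_vec_def mult.commute)
  ultimately show ?thesis
    by (simp only: meas_def complex_norm_square)
qed

text \<open>All rows but \<open>None\<close> kill the tensors of both \<open>x\<close> and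
  \<open>y\<close>, so injectivity makes these tensors proportional; the modulus of the factor is
  read off a nonzero frame coefficient.\<close>

lemma phase_retrievable_if_elim_op_injective:
  fixes F :: "complex^'n::finite^'m::finite"
  assumes inj: "\<And>D. elim_op a b (conj_mat F) F x (conj_vec x) D = 0 \<Longrightarrow> D = 0"
    and frame: "\<And>w. (\<And>k. cinner w (F $ k) = 0) \<Longrightarrow> w = 0"
  shows "x \<in> phase_retrievable_vectors F"
  unfolding phase_retrievable_vectors_def
proof (intro CollectI allI impI)
  fix y assume mag: "\<forall>k. cmod (cinner y (F $ k)) = cmod (cinner x (F $ k))"
  let ?T = "elim_op a b (conj_mat F) F x (conj_vec x)"
  let ?X = "power_tensor x (conj_vec x)" and ?Y = "power_tensor y (conj_vec y)"
  define p where "p = (\<lambda>_ :: 'n \<times> 'n. a, b)"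
  have zero_iff: "x = 0 \<longleftrightarrow> y = 0"
  proof
    assume "x = 0"
    thus "y = 0" using mag by (intro frame) (simp add: cinner_def)
  next
    assume "y = 0"
    thus "x = 0" using mag by (intro frame) (simp add: cinner_def)
  qed
  show "\<exists>c. cmod c = 1 \<and> y = c *s x"
  proof (cases "x = 0")
    case True
    thus ?thesis using zero_iff by (intro exI[of _ 1]) simp
  next
    case False
    have rows: "?T ?X $ Some r = 0" "?T ?Y $ Some r = 0" for r
      using mag by (cases r; auto intro!: elim_op_power_tensor simp: meas_conj)+
    have nz: "power_tensor w (conj_vec w) $ (\<lambda>_. i, i) \<noteq> 0 \<longleftrightarrow> w $ i \<noteq> 0" for w :: "complex^'n" and i
      by (simp add: power_tensor_def conj_vec_def card_gt_0_iff)
    obtain i where i: "x $ i \<noteq> 0" using False by (auto simp: vec_eq_iff)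
    have X: "?X $ p \<noteq> 0"
    proof
      assume "?X $ p = 0"
      hence "?T ?X $ r = 0" for r
        by (cases r) (auto simp: rows elim_op_None p_def)
      hence "?X = 0" by (intro inj) (simp add: vec_eq_iff)
      thus False using nz[of x i] i by simp
    qed
    interpret T: Vector_Spaces.linear "(*s)" "(*s)" ?T by (rule linear_elim_op)
    \<comment> \<open>The coefficients are chosen to cancel coordinate \<open>p\<close>, the one
      seen by the row \<open>None\<close>.\<close>
    have "?T (?X $ p *s ?Y - ?Y $ p *s ?X) $ r = 0" for r
      by (cases r) (auto simp: rows T.diff T.scale elim_op_None p_def)
    hence "?X $ p *s ?Y - ?Y $ p *s ?X = 0"
      by (intro inj) (simp add: vec_eq_iff)
    hence eq: "?X $ p *s ?Y = ?Y $ p *s ?X" by simp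
    have Y: "?Y $ p \<noteq> 0"
    proof
      assume "?Y $ p = 0"
      hence "?Y = 0" using eq X by simp
      hence "y = 0" using nz[of y] by (simp add: vec_eq_iff)
      thus False using zero_iff False by simp
    qed
    have "?X $ p * ?Y $ (\<lambda>_. i, i) = ?Y $ p * ?X $ (\<lambda>_. i, i)"
      using arg_cong[OF eq, of "\<lambda>D. D $ (\<lambda>_. i, i)"] by simp
    hence yi: "y $ i \<noteq> 0" using nz[of y i] nz[of x i] i X Y by (metis mult_eq_0_iff)
    define c where "c = y $ i / x $ i"
    have yc: "y = c *s x"
      unfolding c_def
      by (rule proportional_if_power_tensor_eq[OF eq X]) (use i yi in \<open>auto simp: conj_vec_def\<close>)
    obtain k where k: "cinner x (F $ k) \<noteq> 0" using frame False by blast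
    have "cinner y (F $ k) = c * cinner x (F $ k)"
      by (simp add: yc cinner_def sum_distrib_left mult.assoc)
    hence "cmod c * cmod (cinner x (F $ k)) = cmod (cinner x (F $ k))"
      using mag by (metis norm_mult)
    hence "cmod c = 1" using k by simp
    thus ?thesis using yc by blast
  qed
qed

subsection \<open>Polynomial dependence and genericity\<close>

text \<open>The determinant is a ring expression in its data, so one argument yields both polynomial
  dependence and continuity.\<close>

locale function_ring =
  fixes P :: "('a \<Rightarrow> complex) \<Rightarrow> bool"
  assumes const: "P (\<lambda>_. c)"
    and add: "P f \<Longrightarrow> P g \<Longrightarrow> P (\<lambda>t. f t + g t)"
    and mult: "P f \<Longrightarrow> P g \<Longrightarrow> P (\<lambda>t. f t * g t)"
begin

lemma diff: "P f \<Longrightarrow> P g \<Longrightarrow> P (\<lambda>t. f t - g t)"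
  using add[of f "\<lambda>t. -1 * g t"] mult[OF const[of "-1"], of g] by simp

lemma sum: "(\<And>i. i \<in> A \<Longrightarrow> P (f i)) \<Longrightarrow> P (\<lambda>t. \<Sum>i\<in>A. f i t)"
  by (induction A rule: infinite_finite_induct) (auto intro: const add)

lemma prod: "(\<And>i. i \<in> A \<Longrightarrow> P (f i)) \<Longrightarrow> P (\<lambda>t. \<Prod>i\<in>A. f i t)"
  by (induction A rule: infinite_finite_induct) (auto intro: const mult)

lemmas ring_intros = const add mult diff sum prod

lemma det:
  fixes M :: "'a \<Rightarrow> complex^'k::finite^'k"
  assumes "\<And>i j. P (\<lambda>t. M t $ i $ j)"
  shows "P (\<lambda>t. det (M t))"
  unfolding det_def by (intro ring_intros assms)

end

text \<open>The operator has more rows than columns; a fixed \<open>L\<close> makes it square, so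
  that a single polynomial being nonzero certifies injectivity.\<close>

definition elim_det :: "'n \<Rightarrow> 'n
    \<Rightarrow> complex^((('n \<times> 'n) \<times> ('n \<times> 'n \<Rightarrow> 'n) \<times> 'm \<times> 'm) option)^(('n \<times> 'n \<Rightarrow> 'n) \<times> 'n)
    \<Rightarrow> complex^'n::finite^'m::finite \<Rightarrow> complex^'n^'m \<Rightarrow> complex^'n \<Rightarrow> complex^'n \<Rightarrow> complex" where
  "elim_det a b L u v x z = det (L ** matrix (elim_op a b u v x z))"

lemma (in function_ring) elim_det:
  fixes u v :: "'a \<Rightarrow> complex^'n::finite^'m::finite"
  assumes "\<And>k i. P (\<lambda>t. u t $ k $ i)" "\<And>k i. P (\<lambda>t. v t $ k $ i)"
    and "\<And>i. P (\<lambda>t. x t $ i)" "\<And>i. P (\<lambda>t. z t $ i)"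
  shows "P (\<lambda>t. elim_det a b L (u t) (v t) (x t) (z t))"
  unfolding elim_det_def
proof (rule det)
  have op: "P (\<lambda>t. elim_op a b (u t) (v t) (x t) (z t) D $ r)" for D r
  proof (cases r)
    case None
    thus ?thesis by (simp add: elim_op_None const)
  next
    case (Some r')
    obtain s \<beta> k l where "r' = (s, \<beta>, k, l)" by (cases r')
    thus ?thesis
      unfolding Some by (simp only: elim_op_Some meas_def) (intro ring_intros assms)
  qed
  show "P (\<lambda>t. (L ** matrix (elim_op a b (u t) (v t) (x t) (z t))) $ i $ j)" for i j
    by (simp only: matrix_matrix_mult_def matrix_def vec_lambda_beta) (intro ring_intros op)
qed

lemma elim_op_injective_if_elim_det_nz:
  assumes "elim_det a b L u v x z \<noteq> 0" and "elim_op a b u v x z D = 0"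
  shows "D = 0"
proof -
  let ?M = "matrix (elim_op a b u v x z)"
  have "?M *v D = 0"
    using assms(2) by (simp add: matrix_works[OF linear_elim_op])
  hence "(L ** ?M) *v D = 0"
    by (simp add: matrix_vector_mul_assoc [symmetric])
  moreover have "invertible (L ** ?M)"
    using assms(1) by (simp add: elim_det_def invertible_det_nz)
  ultimately show ?thesis
    using matrix_left_invertible_ker invertible_left_inverse by blast
qed

text \<open>Polynomials in one variable suffice, along lines: \<open>g\<close> is the identity for
  complex lines and \<open>of_real\<close> for real ones.\<close>

definition poly_in :: "('a \<Rightarrow> complex) \<Rightarrow> ('a \<Rightarrow> complex) \<Rightarrow> bool" where
  "poly_in g f \<longleftrightarrow> (\<exists>p. \<forall>t. f t = poly p (g t))"

interpretation poly_in: function_ring "poly_in g"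
proof
  show "poly_in g (\<lambda>_. c)" for c
    unfolding poly_in_def by (intro exI[of _ "[:c:]"]) simp
next
  fix f h assume "poly_in g f" "poly_in g h"
  then obtain p q where "\<forall>t. f t = poly p (g t)" "\<forall>t. h t = poly q (g t)"
    unfolding poly_in_def by blast
  thus "poly_in g (\<lambda>t. f t + h t)" "poly_in g (\<lambda>t. f t * h t)"
    unfolding poly_in_def by (intro exI[of _ "p + q"] exI[of _ "p * q"]; simp)+
qed

lemma poly_in_line: "poly_in g (\<lambda>t. c + g t * d)"
  unfolding poly_in_def by (intro exI[of _ "[:c, d:]"]) simp

interpretation continuous_fun: function_ring "continuous_on S" for S :: "'a::topological_space set"
  by unfold_locales (auto intro: continuous_intros)

lemma poly_nz_real:
  fixes p :: "complex poly"
  assumes "p \<noteq> 0" "a < b"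
  obtains t :: real where "a < t" "t < b" "poly p (of_real t) \<noteq> 0"
proof -
  have "finite {z. poly p z = 0}" using assms(1) by (rule poly_roots_finite)
  hence "finite (of_real -` {z. poly p z = 0} :: real set)"
    by (rule finite_vimageI) (simp add: inj_on_def)
  hence "\<not> {a<..<b} \<subseteq> of_real -` {z. poly p z = 0}"
    using infinite_Ioo[OF assms(2)] finite_subset by blast
  then obtain t where "t \<in> {a<..<b}" "poly p (of_real t) \<noteq> 0" by blast
  thus ?thesis by (intro that[of t]) auto
qed

text \<open>Along the segment from \<open>x\<close> towards \<open>y\<close>, \<open>f\<close> is a
  polynomial in \<open>t\<close> that is nonzero at \<open>t = 1\<close>; its finitely many roots
  leave nonzero values arbitrarily close to \<open>x\<close>.\<close>

lemma dense_nonzero_set: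
  fixes f :: "'v::real_normed_vector \<Rightarrow> complex"
  assumes poly: "\<And>x h. poly_in of_real (\<lambda>t. f (x + t *\<^sub>R h))" and nz: "f y \<noteq> 0"
  shows "closure {x. f x \<noteq> 0} = UNIV"
proof -
  have "\<exists>w\<in>{x. f x \<noteq> 0}. dist w x < e" if e: "e > 0" for x and e :: real
  proof -
    define h where "h = y - x"
    obtain p where p: "f (x + t *\<^sub>R h) = poly p (of_real t)" for t
      using poly[of x h] unfolding poly_in_def by blast
    have "poly p 1 \<noteq> 0" using p[of 1] nz by (simp add: h_def)
    hence "p \<noteq> 0" by auto
    moreover have pos: "0 < e / (norm h + 1)" using e by (simp add: add_nonneg_pos)
    ultimately obtain t where t: "0 < t" "t < e / (norm h + 1)" "poly p (of_real t) \<noteq> 0"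
      by (rule poly_nz_real)
    have "t * norm h \<le> t * (norm h + 1)" using t by simp
    also have "\<dots> < e" using t by (simp add: pos_less_divide_eq add_nonneg_pos)
    finally have "dist (x + t *\<^sub>R h) x < e" using t by (simp add: dist_norm)
    thus ?thesis using p[of t] t by (intro bexI[of _ "x + t *\<^sub>R h"]) simp_all
  qed
  thus ?thesis by (auto simp: closure_approachable)
qed

text \<open>Conjugates of \<open>F\<close> and \<open>x\<close> enter here, so polynomial dependence
  is used along real lines only.\<close>

definition real_elim_det where
  "real_elim_det a b L F x = elim_det a b L (conj_mat F) F x (conj_vec x)"

lemma real_elim_det_witness:
  assumes "CARD('m::finite) \<ge> 2 * CARD('n::finite)"
  obtains a b :: "'n::finite" and L and F :: "complex^'n^'m::finite" and x
  where "real_elim_det a b L F x \<noteq> 0"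
proof -
  obtain a b :: 'n and u v :: "complex^'n^'m" and x z
    where inj: "\<And>D. elim_op a b u v x z D = 0 \<Longrightarrow> D = 0"
    using elim_op_injective_witness[OF assms] by metis
  have "\<forall>D. matrix (elim_op a b u v x z) *v D = 0 \<longrightarrow> D = 0"
    using inj by (simp add: matrix_works[OF linear_elim_op])
  then obtain L where L: "L ** matrix (elim_op a b u v x z) = mat 1"
    using matrix_left_invertible_ker by blast
  \<comment> \<open>Write the witness as \<open>A + \<i> B\<close> with real points \<open>A, B\<close>; the determinant is a nonzero polynomial on the line \<open>A + t B\<close>.\<close>
  define re where "re p q = (p + cnj q) / 2" for p q :: complex
  define im where "im p q = (p - cnj q) / (2 * \<i>)" for p q :: complex
  have re_im: "re p q + \<i> * im p q = p" for p q
    by (simp add: re_def im_def field_simps)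
  \<comment> \<open>The relevant antilinear involution conjugates while swapping \<open>u\<close>
    with \<open>v\<close> and \<open>x\<close> with \<open>z\<close>. The parts \<open>re\<close>
    and \<open>im\<close> are taken with respect to it, hence their two arguments; real
    \<open>t\<close> gives its fixed points.\<close>
  have cnj_line: "cnj (re p q + of_real t * im p q) = re q p + of_real t * im q p" for p q t
    by (simp add: re_def im_def field_simps)
  define U where "U t = (\<chi> k i. re (u $ k $ i) (v $ k $ i) + t * im (u $ k $ i) (v $ k $ i))" for t
  define V where "V t = (\<chi> k i. re (v $ k $ i) (u $ k $ i) + t * im (v $ k $ i) (u $ k $ i))" for t
  define X where "X t = (\<chi> i. re (x $ i) (z $ i) + t * im (x $ i) (z $ i))" for t
  define Z where "Z t = (\<chi> i. re (z $ i) (x $ i) + t * im (z $ i) (x $ i))" for t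
  have "poly_in (\<lambda>t. t) (\<lambda>t. elim_det a b L (U t) (V t) (X t) (Z t))"
    by (rule poly_in.elim_det) (simp_all add: U_def V_def X_def Z_def poly_in_line)
  then obtain p where p: "elim_det a b L (U t) (V t) (X t) (Z t) = poly p t" for t
    unfolding poly_in_def by blast
  have "U \<i> = u" "V \<i> = v" "X \<i> = x" "Z \<i> = z"
    by (simp_all add: U_def V_def X_def Z_def vec_eq_iff re_im)
  hence "poly p \<i> \<noteq> 0"
    using p[of \<i>] L by (simp add: elim_det_def)
  hence "p \<noteq> 0" by auto
  then obtain t :: real where t: "poly p (of_real t) \<noteq> 0"
    using poly_nz_real[of p 0 1] by auto
  have "U (of_real t) = conj_mat (V (of_real t))" "Z (of_real t) = conj_vec (X (of_real t))"
    by (simp_all add: U_def V_def X_def Z_def conj_mat_def conj_vec_def vec_eq_iff cnj_line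
        del: complex_cnj_add)
  hence "real_elim_det a b L (V (of_real t)) (X (of_real t)) \<noteq> 0"
    using p[of "of_real t"] t by (simp add: real_elim_det_def)
  thus ?thesis by (rule that)
qed

lemma poly_in_real_elim_det:
  assumes F: "\<And>k i. \<exists>c d. \<forall>t::real. F t $ k $ i = c + of_real t * d"
    and x: "\<And>i. \<exists>c d. \<forall>t::real. x t $ i = c + of_real t * d"
  shows "poly_in of_real (\<lambda>t. real_elim_det a b L (F t) (x t))"
proof -
  have 1: "poly_in of_real f \<and> poly_in of_real (\<lambda>t. cnj (f t))"
    if f: "\<exists>c d. \<forall>t::real. f t = c + of_real t * d" for f
  proof -
    obtain c d where "\<And>t. f t = c + of_real t * d" using f by blast
    hence "f = (\<lambda>t. c + of_real t * d)" "(\<lambda>t. cnj (f t)) = (\<lambda>t. cnj c + of_real t * cnj d)" by auto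
    thus ?thesis using poly_in_line[of of_real] by metis
  qed
  show ?thesis
    unfolding real_elim_det_def
    by (rule poly_in.elim_det) (use 1[OF F] 1[OF x] in \<open>simp_all add: conj_mat_def conj_vec_def\<close>)
qed

lemma continuous_real_elim_det:
  assumes "continuous_on S F" "continuous_on S x"
  shows "continuous_on S (\<lambda>t. real_elim_det a b L (F t) (x t))"
  unfolding real_elim_det_def
  by (rule continuous_fun.elim_det) (auto simp: conj_mat_def conj_vec_def intro!: continuous_intros assms)

section \<open>Frames, analysis ranges and change of basis\<close>

lemma conj_mat_conj_mat [simp]: "conj_mat (conj_mat A) = A"
  by (simp add: conj_mat_def vec_eq_iff)

lemma conj_mat_mult: "conj_mat (A ** B) = conj_mat A ** conj_mat B"
  by (simp add: conj_mat_def matrix_matrix_mult_def vec_eq_iff)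

lemma conj_mat_mat_1 [simp]: "conj_mat (mat 1) = mat 1"
  by (simp add: conj_mat_def mat_def vec_eq_iff)

lemma cinner_row: "cinner x (F $ k) = (conj_mat F *v x) $ k"
  by (simp add: cinner_def conj_mat_def matrix_vector_mult_def mult.commute)

lemma analysis_range_eq: "analysis_range F = range ((*v) (conj_mat F))"
  by (simp add: analysis_range_def cinner_row)

lemma is_frame_iff_left_invertible: "is_frame F \<longleftrightarrow> (\<exists>L. L ** F = mat 1)"
proof
  assume "is_frame F"
  hence "\<forall>i. \<exists>c. axis i 1 = (\<Sum>k\<in>UNIV. c k *s F $ k)" unfolding is_frame_def by blast
  then obtain c where c: "\<And>i. axis i 1 = (\<Sum>k\<in>UNIV. c i k *s F $ k)" by metis
  have "(\<Sum>k\<in>UNIV. c i k * F $ k $ j) = (if i = j then 1 else 0)" for i j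
    using arg_cong[OF c[of i], of "\<lambda>x. x $ j"] by (auto simp: axis_def sum_component)
  hence "(\<chi> i k. c i k) ** F = mat 1"
    by (simp add: matrix_matrix_mult_def mat_def vec_eq_iff)
  thus "\<exists>L. L ** F = mat 1" by blast
next
  assume "\<exists>L. L ** F = mat 1"
  then obtain L where L: "L ** F = mat 1" by blast
  have "x = (\<Sum>k\<in>UNIV. (x v* L) $ k *s F $ k)" for x
  proof -
    have "(x v* L) v* F = x" by (simp add: vector_matrix_mul_assoc L)
    moreover have "y v* F = (\<Sum>k\<in>UNIV. y $ k *s F $ k)" for y
      by (simp add: vec_eq_iff vector_matrix_mult_def sum_component mult.commute)
    ultimately show ?thesis by metis
  qed
  thus "is_frame F" unfolding is_frame_def by blast
qed

text \<open>A left inverse exists iff \<open>det (L ** F) \<noteq> 0\<close> for some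
  \<open>L\<close>, which exhibits the frames as a union of open sets.\<close>

lemma open_frames: "open {F :: complex^'n::finite^'m::finite. is_frame F}"
proof -
  have "(\<exists>L. L ** F = mat 1) \<longleftrightarrow> (\<exists>L. det (L ** F) \<noteq> 0)" for F :: "complex^'n^'m"
  proof
    assume "\<exists>L. det (L ** F) \<noteq> 0"
    then obtain L :: "complex^'m^'n" where "invertible (L ** F)" using invertible_det_nz by blast
    then obtain M where "M ** (L ** F) = mat 1" using invertible_left_inverse by blast
    hence "(M ** L) ** F = mat 1" by (simp add: matrix_mul_assoc)
    thus "\<exists>L. L ** F = mat 1" by blast
  next
    assume "\<exists>L. L ** F = mat 1"
    then obtain L where "L ** F = mat 1" by blast
    hence "det (L ** F) \<noteq> 0" by simp
    thus "\<exists>L. det (L ** F) \<noteq> 0" by blast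
  qed
  hence "{F :: complex^'n^'m. is_frame F} = (\<Union>L. {F. det (L ** F) \<noteq> 0})"
    by (auto simp: is_frame_iff_left_invertible)
  moreover have "open {F :: complex^'n^'m. det (L ** F) \<noteq> 0}" for L
    by (intro open_Collect_neq continuous_fun.det)
       (auto simp: matrix_matrix_mult_def intro!: continuous_intros)
  ultimately show ?thesis by auto
qed

lemma frame_analysis_injective:
  assumes "is_frame F" "\<And>k. cinner w (F $ k) = 0"
  shows "w = 0"
proof -
  obtain L where L: "L ** F = mat 1" using assms(1) is_frame_iff_left_invertible by blast
  have "conj_mat F *v w = 0" using assms(2) by (simp add: cinner_row vec_eq_iff)
  hence "(conj_mat L ** conj_mat F) *v w = 0"
    by (simp add: matrix_vector_mul_assoc [symmetric])
  thus ?thesis by (simp add: conj_mat_mult[symmetric] L)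
qed

lemma factor_if_range_subset:
  fixes A B :: "'a::field^'n::finite^'m::finite"
  assumes "range ((*v) B) \<subseteq> range ((*v) A)"
  obtains R where "B = A ** R"
proof -
  have "\<forall>j. \<exists>r. B *v axis j 1 = A *v r" using assms by blast
  then obtain r where r: "\<And>j. B *v axis j 1 = A *v r j" by metis
  have "B $ i $ j = (A ** (\<chi> i j. r j $ i)) $ i $ j" for i j
  proof -
    have "B $ i $ j = (A *v r j) $ i"
      unfolding r[symmetric] by (simp add: matrix_vector_mult_def axis_def if_distrib cong: if_cong)
    thus ?thesis by (simp add: matrix_matrix_mult_def matrix_vector_mult_def)
  qed
  hence "B = A ** (\<chi> i j. r j $ i)" unfolding vec_eq_iff by blast
  thus ?thesis by (rule that)
qed

text \<open>Equal ranges give factorisations both ways; cancelling \<open>F\<close> by a left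
  inverse shows that the two square factors are mutually inverse.\<close>

lemma frames_with_same_analysis_range:
  fixes F G :: "complex^'n::finite^'m::finite"
  assumes "is_frame F" "analysis_range F = analysis_range G"
  obtains T where "invertible T" "F = G ** T"
proof -
  obtain R R' where R: "conj_mat F = conj_mat G ** R" "conj_mat G = conj_mat F ** R'"
    using assms(2) factor_if_range_subset unfolding analysis_range_eq by (metis order_refl)
  have F: "F = G ** conj_mat R" and G: "G = F ** conj_mat R'"
    using R[THEN arg_cong[of _ _ conj_mat]] by (simp_all add: conj_mat_mult)
  obtain L where L: "L ** F = mat 1" using assms(1) is_frame_iff_left_invertible by blast
  have "mat 1 = L ** (F ** (conj_mat R' ** conj_mat R))"
    using F G L by (metis matrix_mul_assoc)
  also have "\<dots> = conj_mat R' ** conj_mat R"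
    by (simp add: matrix_mul_assoc L)
  finally have "invertible (conj_mat R)" using invertible_left_inverse by metis
  thus ?thesis using F that by blast
qed

text \<open>Passing from \<open>F\<close> to \<open>F ** T\<close> amounts to measuring
  \<open>conj_mat T *v w\<close> instead of \<open>w\<close>, and this linear map commutes with
  phase factors.\<close>

lemma phase_retrievable_change_basis:
  assumes "x \<in> phase_retrievable_vectors (F ** T)" "T ** S = mat 1"
  shows "conj_mat T *v x \<in> phase_retrievable_vectors F"
  unfolding phase_retrievable_vectors_def
proof (intro CollectI allI impI)
  fix y assume mag: "\<forall>k. cmod (cinner y (F $ k)) = cmod (cinner (conj_mat T *v x) (F $ k))"
  have y: "y = conj_mat T *v (conj_mat S *v y)"
    using assms(2) by (simp add: matrix_vector_mul_assoc conj_mat_mult[symmetric])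
  have c: "cinner w ((F ** T) $ k) = cinner (conj_mat T *v w) (F $ k)" for w k
    by (simp add: cinner_row conj_mat_mult matrix_vector_mul_assoc)
  have "\<forall>k. cmod (cinner (conj_mat S *v y) ((F ** T) $ k)) = cmod (cinner x ((F ** T) $ k))"
    using mag by (simp add: c y[symmetric])
  then obtain d where "cmod d = 1" "conj_mat S *v y = d *s x"
    using assms(1) unfolding phase_retrievable_vectors_def by blast
  thus "\<exists>d. cmod d = 1 \<and> y = d *s (conj_mat T *v x)"
    using y by (metis vector_scalar_commute)
qed

section \<open>The open dense sets of frames and of vectors\<close>

theorem theorem3p4:
  assumes "CARD('m::finite) \<ge> 2 * CARD('n::finite)"
  shows "generic_frames (\<lambda>F :: complex^'n^'m.
           \<exists>V. open V \<and> closure V = UNIV \<and> V \<subseteq> phase_retrievable_vectors F)"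
proof -
  obtain a b :: 'n and L and F0 :: "complex^'n^'m" and x0
    where wit: "real_elim_det a b L F0 x0 \<noteq> 0"
    using real_elim_det_witness[OF assms] by metis
  let ?q = "real_elim_det a b L"
  \<comment> \<open>The matrix \<open>T\<close> makes \<open>U\<close> saturated: frames with the same analysis range differ by a change of basis.\<close>
  define U where "U = {F :: complex^'n^'m. is_frame F \<and> (\<exists>T x. invertible T \<and> ?q (F ** T) x \<noteq> 0)}"
  have "open U"
  proof -
    have "U = {F. is_frame F} \<inter> (\<Union>T\<in>{T. invertible T}. \<Union>x. {F. ?q (F ** T) x \<noteq> 0})"
      by (auto simp: U_def)
    moreover have "open {F. ?q (F ** T) x \<noteq> 0}" for T x
      by (intro open_Collect_neq continuous_real_elim_det)
         (auto simp: matrix_matrix_mult_def intro!: continuous_intros)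
    ultimately show ?thesis using open_frames by (auto intro!: open_Int open_UN)
  qed
  moreover have "{F. is_frame F} \<subseteq> closure U"
  proof -
    \<comment> \<open>Density is already achieved with the fixed vector \<open>x0\<close> and the
      identity as \<open>T\<close>.\<close>
    have "closure {F. ?q F x0 \<noteq> 0} = UNIV"
    proof (rule dense_nonzero_set[where f = "\<lambda>F. ?q F x0", OF _ wit])
      show "poly_in of_real (\<lambda>t. ?q (F + t *\<^sub>R H) x0)" for F H
      proof (rule poly_in_real_elim_det)
        fix k i
        show "\<exists>c d. \<forall>t. (F + t *\<^sub>R H) $ k $ i = c + of_real t * d"
          unfolding vector_add_component vector_scaleR_component
          by (rule exI[of _ "F $ k $ i"], rule exI[of _ "H $ k $ i"]) (simp add: scaleR_conv_of_real)
        show "\<exists>c d. \<forall>t. x0 $ i = c + of_real t * d"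
          by (rule exI[of _ "x0 $ i"], rule exI[of _ 0]) simp
      qed
    qed
    hence "{F. is_frame F} \<subseteq> closure ({F. is_frame F} \<inter> {F. ?q F x0 \<noteq> 0})"
      using open_Int_closure_subset[OF open_frames] by blast
    also have "\<dots> \<subseteq> closure U"
    proof (rule closure_mono, safe)
      fix F assume "is_frame F" "?q F x0 \<noteq> 0"
      hence "?q (F ** mat 1) x0 \<noteq> 0" "invertible (mat 1 :: complex^'n^'n)"
        by (simp_all add: invertible_det_nz)
      thus "F \<in> U" using \<open>is_frame F\<close> unfolding U_def by blast
    qed
    finally show ?thesis .
  qed
  moreover have "G \<in> U" if F: "F \<in> U" and G: "is_frame G" "analysis_range G = analysis_range F" for F G
  proof -
    obtain S where S: "invertible S" "F = G ** S"
      using frames_with_same_analysis_range[of F G] F G by (auto simp: U_def)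
    obtain T x where T: "invertible T" "?q (F ** T) x \<noteq> 0" using F by (auto simp: U_def)
    have "invertible (S ** T)" "?q (G ** (S ** T)) x \<noteq> 0"
      using S T by (simp_all add: invertible_mult matrix_mul_assoc)
    thus ?thesis using G by (auto simp: U_def)
  qed
  moreover have "\<exists>V. open V \<and> closure V = UNIV \<and> V \<subseteq> phase_retrievable_vectors F" if F: "F \<in> U" for F
  proof -
    obtain T x1 where T: "invertible T" "?q (F ** T) x1 \<noteq> 0" and frame: "is_frame F"
      using F by (auto simp: U_def)
    obtain S where S: "T ** S = mat 1" "S ** T = mat 1" using T(1) by (auto simp: invertible_def)
    obtain K where "K ** F = mat 1" using frame is_frame_iff_left_invertible by blast
    hence "(S ** K) ** (F ** T) = mat 1"
      using S by (metis matrix_mul_assoc matrix_mul_lid)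
    hence frame': "is_frame (F ** T)" using is_frame_iff_left_invertible by blast
    \<comment> \<open>The map \<open>conj_mat T\<close> carries good vectors for
      \<open>F ** T\<close> to good vectors for \<open>F\<close>, so the condition is tested after
      applying its inverse \<open>conj_mat S\<close>.\<close>
    define V where "V = {x. ?q (F ** T) (conj_mat S *v x) \<noteq> 0}"
    have "open V"
      unfolding V_def
      by (intro open_Collect_neq continuous_real_elim_det)
         (auto simp: matrix_vector_mult_def intro!: continuous_intros)
    moreover have "closure V = UNIV"
      unfolding V_def
    proof (rule dense_nonzero_set)
      show "?q (F ** T) (conj_mat S *v (conj_mat T *v x1)) \<noteq> 0"
        using T by (simp add: matrix_vector_mul_assoc conj_mat_mult[symmetric] S)
      fix x h
      have "(conj_mat S *v (x + t *\<^sub>R h)) $ i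
          = (conj_mat S *v x) $ i + of_real t * (conj_mat S *v h) $ i" for t i
        unfolding matrix_vector_right_distrib vector_add_component
        by (simp add: matrix_vector_mult_def scaleR_sum_right scaleR_conv_of_real[symmetric])
      moreover have "\<exists>c d. \<forall>t. (F ** T) $ k $ i = c + of_real t * d" for k i
        by (rule exI[of _ "(F ** T) $ k $ i"], rule exI[of _ 0]) simp
      ultimately show "poly_in of_real (\<lambda>t. ?q (F ** T) (conj_mat S *v (x + t *\<^sub>R h)))"
        by (intro poly_in_real_elim_det) blast+
    qed
    moreover have "V \<subseteq> phase_retrievable_vectors F"
    proof
      fix x assume "x \<in> V"
      hence "?q (F ** T) (conj_mat S *v x) \<noteq> 0" by (simp add: V_def)
      hence "conj_mat S *v x \<in> phase_retrievable_vectors (F ** T)"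
        unfolding real_elim_det_def
        using elim_op_injective_if_elim_det_nz frame_analysis_injective[OF frame']
        by (metis phase_retrievable_if_elim_op_injective)
      hence "conj_mat T *v (conj_mat S *v x) \<in> phase_retrievable_vectors F"
        by (rule phase_retrievable_change_basis[OF _ S(1)])
      thus "x \<in> phase_retrievable_vectors F"
        by (simp add: matrix_vector_mul_assoc conj_mat_mult[symmetric] S)
    qed
    ultimately show ?thesis by blast
  qed
  moreover have "U \<subseteq> {F. is_frame F}"
    by (auto simp: U_def)
  ultimately show ?thesis
    unfolding generic_frames_def by (intro exI[of _ U]) blast
qed

end
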